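(* Let $n\geq 1$ and $k\geq 1$ be integers. Let $R_{2}^{(k)}$ denote the number of tuples $(Y_1,Y_2,U_{1}^{(1)},\ldots,U_{n}^{(1)},U_{1}^{(2)},\ldots,U_{n}^{(2)})\in(\mathbb{F}_{2}[T])^{2n+2}$ satisfying the degree conditions $\deg Y_i\leq k-1$ for $i=1,2$ and $\deg U_{j}^{(i)}\leq 1$ for $1\leq j\leq n$, $1\leq i\leq 2$ (the zero polynomial is allowed, with degree $-\infty$), and solving the polynomial system $$Y_{1}U_{j}^{(1)}+Y_{2}U_{j}^{(2)}=0\qquad (j=1,\ldots,n).$$ Then $$R_{2}^{(k)}=2^{2k}+3\cdot(2^{2n}-1)\cdot 2^{k}+6\cdot(2^{n}-1)\cdot 2^{k-1}+2^{4n}-3\cdot 2^{2n}-6\cdot 2^{n}+8.$$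
   Context: $\mathbb{F}_2$ is the field with two elements and $\mathbb{F}_2[T]$ the polynomial ring over it. *)

theory Defs
  imports "HOL-Computational_Algebra.Polynomial" "HOL-Library.Z2" "HOL-Library.FuncSet"
begin

text \<open>
  The type \<^typ>\<open>bit\<close> is the field with two elements.  The families
  \<open>(U_1,\<dots>,U_n)\<close> are elements of \<open>{1..n} \<rightarrow>\<^sub>E _\<close>, i.e. functions fixed to be
  undefined outside \<open>{1..n}\<close>, so that they correspond bijectively to \<open>n\<close>-tuples.
  As \<^prop>\<open>degree (0 :: bit poly) = 0\<close>, the zero polynomial satisfies every bound
  \<open>degree p \<le> d\<close>, in accordance with the convention \<open>deg 0 = -\<infinity>\<close>.
\<close>

definition solutions :: "nat \<Rightarrow> nat \<Rightarrow>
    (bit poly \<times> bit poly \<times> (nat \<Rightarrow> bit poly) \<times> (nat \<Rightarrow> bit poly)) set" where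
  "solutions n k = {(Y1, Y2, U1, U2).
     degree Y1 \<le> k - 1 \<and> degree Y2 \<le> k - 1 \<and>
     U1 \<in> {1..n} \<rightarrow>\<^sub>E {p. degree p \<le> 1} \<and>
     U2 \<in> {1..n} \<rightarrow>\<^sub>E {p. degree p \<le> 1} \<and>
     (\<forall>j\<in>{1..n}. Y1 * U1 j + Y2 * U2 j = 0)}"

definition R2 :: "nat \<Rightarrow> nat \<Rightarrow> nat" where
  "R2 n k = card (solutions n k)"

end

theory Submission
  imports Defs
begin

text \<open>
  For fixed \<open>Y = (Y\<^sub>1, Y\<^sub>2)\<close> the \<open>n\<close> equations are independent, so the number of solutions is
  \<open>N(Y)\<^sup>n\<close>, where \<open>N(Y)\<close> counts the pairs \<open>(u, v)\<close> of degree at most \<open>1\<close> with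
  \<open>Y\<^sub>1 u = Y\<^sub>2 v\<close> (signs do not matter in characteristic 2).
  Clearly \<open>N(0) = 16\<close>.  If \<open>Y \<noteq> 0\<close>, then \<open>Y = g (a, b)\<close> with \<open>a, b\<close> coprime and the pairs
  are the multiples \<open>h (b, a)\<close>.  Hence \<open>N(Y)\<close> is \<open>4\<close>, \<open>2\<close> or \<open>1\<close> according as the larger of
  the degrees of \<open>a, b\<close> is \<open>0\<close>, \<open>1\<close> or at least \<open>2\<close>.  There are 3 coprime pairs
  of the first kind and 6 of the second, so it remains to count the possible \<open>g\<close>.
\<close>

section \<open>Polynomials of bounded degree over the two-element field\<close>

definition polys_below :: "nat \<Rightarrow> bit poly set" where
  "polys_below m = {p. p = 0 \<or> degree p < m}"

lemma zero_in_polys_below [simp]: "0 \<in> polys_below m"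
  by (simp add: polys_below_def)

lemma polys_below_Suc_iff: "p \<in> polys_below (Suc m) \<longleftrightarrow> degree p \<le> m"
  by (auto simp: polys_below_def)

lemma polys_below_0: "polys_below 0 = {0}"
  by (auto simp: polys_below_def)

lemma polys_below_Suc: "polys_below (Suc m) = (\<lambda>(c, p). pCons c p) ` (UNIV \<times> polys_below m)"
proof (intro equalityI subsetI)
  fix p assume p: "p \<in> polys_below (Suc m)"
  obtain c q where q: "p = pCons c q" by (cases p)
  with p have "q \<in> polys_below m"
    by (auto simp: polys_below_def degree_pCons_eq_if split: if_splits)
  with q show "p \<in> (\<lambda>(c, p). pCons c p) ` (UNIV \<times> polys_below m)" by force
qed (auto simp: polys_below_def degree_pCons_eq_if split: if_splits)

lemma UNIV_bit_eq: "(UNIV :: bit set) = {0, 1}"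
  by (auto intro: bit.exhaust)

lemma finite_card_polys_below: "finite (polys_below m) \<and> card (polys_below m) = 2 ^ m"
proof (induction m)
  case 0
  then show ?case by (simp add: polys_below_0)
next
  case (Suc m)
  have "inj_on (\<lambda>(c :: bit, p). pCons c p) (UNIV \<times> polys_below m)"
    by (auto simp: inj_on_def)
  with Suc show ?case
    by (simp add: polys_below_Suc card_image card_cartesian_product UNIV_bit_eq)
qed

lemmas finite_polys_below [simp] = finite_card_polys_below [THEN conjunct1]
lemmas card_polys_below = finite_card_polys_below [THEN conjunct2]

lemma polys_below_2: "polys_below 2 = {0, 1, [:0, 1:], [:1, 1:]}"
  by (simp add: eval_nat_numeral polys_below_Suc polys_below_0 UNIV_bit_eq pCons_one insert_commute)

lemma one_neq_linear_bit_poly [simp]: "1 \<noteq> [:c, 1 :: bit:]" "[:c, 1 :: bit:] \<noteq> 1"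
proof -
  have "degree [:c, 1 :: bit:] \<noteq> degree (1 :: bit poly)" by simp
  then show "1 \<noteq> [:c, 1 :: bit:]" "[:c, 1 :: bit:] \<noteq> 1" by metis+
qed

lemma two_bit_poly_eq_0: "(2 :: bit poly) = 0"
  by (simp add: numeral_poly)

lemma add_bit_poly_eq_0_iff: "p + q = 0 \<longleftrightarrow> p = (q :: bit poly)"
proof -
  have "q + q = 0" by (metis mult_2 mult_zero_left two_bit_poly_eq_0)
  then show ?thesis by (metis add.right_cancel)
qed

section \<open>Coprime pairs in Bezout form\<close>

definition comaximal :: "bit poly \<Rightarrow> bit poly \<Rightarrow> bool" where
  "comaximal a b \<longleftrightarrow> (\<exists>r s. r * a + s * b = 1)"

lemma comaximal_commute: "comaximal a b \<Longrightarrow> comaximal b a"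
  unfolding comaximal_def by (metis add.commute)

text \<open>If \<open>r * a + s * b = 1\<close>, the multiplier is \<open>r * x + s * y\<close>:
  multiply the Bezout identity by \<open>x\<close> or \<open>y\<close> and exchange
  \<open>x * b\<close> with \<open>y * a\<close>.\<close>

lemma comaximal_proportional:
  assumes "comaximal a b" and xy: "x * b = y * a"
  obtains g where "x = g * a" "y = g * b"
proof -
  obtain r s where rs: "r * a + s * b = 1"
    using assms by (auto simp: comaximal_def)
  have "x = (r * x + s * y) * a"
  proof -
    have "x = x * (r * a + s * b)" using rs by simp
    also have "\<dots> = r * x * a + s * (x * b)" by (simp add: algebra_simps)
    also have "\<dots> = (r * x + s * y) * a" unfolding xy by (simp add: algebra_simps)
    finally show ?thesis .
  qed
  moreover have "y = (r * x + s * y) * b"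
  proof -
    have "y = y * (r * a + s * b)" using rs by simp
    also have "\<dots> = r * (y * a) + s * y * b" by (simp add: algebra_simps)
    also have "\<dots> = (r * x + s * y) * b" unfolding xy[symmetric] by (simp add: algebra_simps)
    finally show ?thesis .
  qed
  ultimately show ?thesis by (rule that)
qed

lemma bit_poly_mult_eq_1:
  fixes p q :: "bit poly"
  assumes "p * q = 1"
  shows "p = 1"
proof -
  have "is_unit p" using assms by (metis dvd_triv_left)
  then obtain c where "p = [:c:]" "c \<noteq> 0" by (auto simp: is_unit_poly_iff)
  then show ?thesis by (cases c) (auto simp: pCons_one)
qed

text \<open>Cross-multiplication makes the two pairs proportional with some factor \<open>h\<close>.
  Bezout for the second pair forces \<open>h\<close> to be a unit, and 1 is the only unit here, so
  the factorisation is unique on the nose and not just up to scalars.\<close>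

lemma comaximal_multiple_unique:
  assumes ab: "comaximal a b" and ab': "comaximal a' b'" and "g \<noteq> 0" "g' \<noteq> 0"
    and eq: "g * a = g' * a'" "g * b = g' * b'"
  shows "g = g' \<and> a = a' \<and> b = b'"
proof -
  have "(g * g') * (a' * b) = (g * b) * (g' * a')" by (simp add: algebra_simps)
  also have "\<dots> = (g' * b') * (g * a)" by (simp only: eq)
  also have "\<dots> = (g * g') * (b' * a)" by (simp add: algebra_simps)
  finally have cross: "a' * b = b' * a" using \<open>g \<noteq> 0\<close> \<open>g' \<noteq> 0\<close> by simp
  obtain h where h: "a' = h * a" "b' = h * b"
    using comaximal_proportional[OF ab cross] by blast
  obtain r s where "r * a' + s * b' = 1" using ab' by (auto simp: comaximal_def)
  then have "h * (r * a + s * b) = 1" by (simp add: h algebra_simps)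
  then have "h = 1" by (rule bit_poly_mult_eq_1)
  with h have same: "a' = a" "b' = b" by simp_all
  have "a \<noteq> 0 \<or> b \<noteq> 0" using ab by (auto simp: comaximal_def)
  with same eq show ?thesis by auto
qed

section \<open>Annihilators of multiples of a coprime pair\<close>

definition height :: "bit poly \<times> bit poly \<Rightarrow> nat" where
  "height = (\<lambda>(a, b). max (degree a) (degree b))"

text \<open>Degrees add and \<open>a\<close>, \<open>b\<close> are not both 0, so for nonzero
  \<open>g\<close> the larger of the two product degrees is \<open>degree g + height (a, b)\<close>.
  If the height is at least \<open>m\<close>, both sides say \<open>g = 0\<close>.\<close>

lemma multiple_in_polys_below_iff:
  assumes "comaximal a b"
  shows "g * a \<in> polys_below m \<and> g * b \<in> polys_below m \<longleftrightarrow> g \<in> polys_below (m - height (a, b))"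
proof (cases "g = 0")
  case False
  have "a \<noteq> 0 \<or> b \<noteq> 0" using assms by (auto simp: comaximal_def)
  with False show ?thesis
    by (cases "a = 0"; cases "b = 0")
      (auto simp: polys_below_def height_def degree_mult_eq)
qed simp

definition ann :: "bit poly \<times> bit poly \<Rightarrow> (bit poly \<times> bit poly) set" where
  "ann = (\<lambda>(y1, y2). {(u, v). u \<in> polys_below 2 \<and> v \<in> polys_below 2 \<and> y1 * u + y2 * v = 0})"

lemma ann_iff:
  "z \<in> ann y \<longleftrightarrow> fst z \<in> polys_below 2 \<and> snd z \<in> polys_below 2 \<and> fst y * fst z + snd y * snd z = 0"
  by (auto simp: ann_def split: prod.splits)

lemma ann_subset: "ann y \<subseteq> polys_below 2 \<times> polys_below 2"
  by (auto simp: ann_def)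

lemma card_ann_multiple:
  assumes ab: "comaximal a b" and "g \<noteq> 0"
  shows "card (ann (g * a, g * b)) = 2 ^ (2 - height (a, b))"
proof -
  have "ann (g * a, g * b) = (\<lambda>h. (h * b, h * a)) ` polys_below (2 - height (a, b))"
  proof (intro equalityI subsetI)
    fix z assume "z \<in> ann (g * a, g * b)"
    then obtain u v where z: "z = (u, v)" "u \<in> polys_below 2" "v \<in> polys_below 2"
      and "g * a * u = g * b * v" by (auto simp: ann_def add_bit_poly_eq_0_iff)
    then have "u * a = v * b" using \<open>g \<noteq> 0\<close> by (simp add: mult.assoc mult.commute)
    then obtain h where "u = h * b" "v = h * a"
      using comaximal_proportional[OF comaximal_commute[OF ab]] by blast
    with z multiple_in_polys_below_iff[OF ab]
    show "z \<in> (\<lambda>h. (h * b, h * a)) ` polys_below (2 - height (a, b))" by blast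
  next
    fix z assume "z \<in> (\<lambda>h. (h * b, h * a)) ` polys_below (2 - height (a, b))"
    with multiple_in_polys_below_iff[OF ab] show "z \<in> ann (g * a, g * b)"
      by (auto simp: ann_def add_bit_poly_eq_0_iff)
  qed
  \<comment> \<open>One of \<open>a\<close>, \<open>b\<close> is nonzero and can be
    cancelled.\<close>
  moreover have "inj_on (\<lambda>h. (h * b, h * a)) (polys_below (2 - height (a, b)))"
    using ab by (auto simp: inj_on_def comaximal_def)
  ultimately show ?thesis by (simp add: card_image card_polys_below)
qed

section \<open>Counting the multiples of coprime pairs of given height\<close>

definition coprime_pairs :: "nat \<Rightarrow> (bit poly \<times> bit poly) set" where
  "coprime_pairs e = {(a, b). comaximal a b \<and> height (a, b) = e}"

text \<open>The bound \<open>k - e\<close> on \<open>g\<close> keeps both products in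
  \<open>polys_below k\<close>. Excluding \<open>g = 0\<close> makes the classes for different
  \<open>e\<close> disjoint.\<close>

definition multiples :: "nat \<Rightarrow> nat \<Rightarrow> (bit poly \<times> bit poly) set" where
  "multiples k e = (\<lambda>(g, a, b). (g * a, g * b)) ` ((polys_below (k - e) - {0}) \<times> coprime_pairs e)"

lemma multiples_iff:
  "y \<in> multiples k e \<longleftrightarrow> (\<exists>g a b. y = (g * a, g * b) \<and> g \<in> polys_below (k - e) \<and> g \<noteq> 0 \<and>
     comaximal a b \<and> height (a, b) = e)"
  by (force simp: multiples_def coprime_pairs_def)

lemma multiples_subset: "multiples k e \<subseteq> polys_below k \<times> polys_below k"
proof
  fix y assume "y \<in> multiples k e"
  then obtain g a b where "y = (g * a, g * b)" "g \<in> polys_below (k - height (a, b))" "comaximal a b"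
    unfolding multiples_iff by blast
  then show "y \<in> polys_below k \<times> polys_below k"
    using multiple_in_polys_below_iff[of a b g k] by simp
qed

lemma zero_notin_multiples: "(0, 0) \<notin> multiples k e"
  by (auto simp: multiples_iff comaximal_def)

lemma multiples_disjoint:
  assumes "e \<noteq> e'"
  shows "multiples k e \<inter> multiples k e' = {}"
proof -
  have "e = e'" if y: "y \<in> multiples k e" and y': "y \<in> multiples k e'" for y
  proof -
    from y obtain g a b where 1: "y = (g * a, g * b)" "g \<noteq> 0" "comaximal a b" "height (a, b) = e"
      unfolding multiples_iff by blast
    from y' obtain g' a' b'
      where 2: "y = (g' * a', g' * b')" "g' \<noteq> 0" "comaximal a' b'" "height (a', b') = e'"
      unfolding multiples_iff by blast
    from 1 2 comaximal_multiple_unique[of a b a' b' g g'] show ?thesis by simp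
  qed
  with assms show ?thesis by blast
qed

lemma card_multiples: "card (multiples k e) = (2 ^ (k - e) - 1) * card (coprime_pairs e)"
proof -
  have "inj_on (\<lambda>(g, a, b). (g * a, g * b)) ((polys_below (k - e) - {0}) \<times> coprime_pairs e)"
  proof (rule inj_onI)
    fix x x'
    assume x: "x \<in> (polys_below (k - e) - {0}) \<times> coprime_pairs e"
      and x': "x' \<in> (polys_below (k - e) - {0}) \<times> coprime_pairs e"
      and eq: "(case x of (g, a, b) \<Rightarrow> (g * a, g * b)) = (case x' of (g, a, b) \<Rightarrow> (g * a, g * b))"
    obtain g a b g' a' b' where xx': "x = (g, a, b)" "x' = (g', a', b')"
      by (cases x, cases x') auto
    have "comaximal a b" "comaximal a' b'" "g \<noteq> 0" "g' \<noteq> 0" "g * a = g' * a'" "g * b = g' * b'"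
      using x x' eq by (simp_all add: xx' coprime_pairs_def)
    then show "x = x'"
      unfolding xx' using comaximal_multiple_unique by blast
  qed
  then show ?thesis
    by (simp add: multiples_def card_image card_cartesian_product card_polys_below)
qed

lemma card_ann_multiples: "y \<in> multiples k e \<Longrightarrow> card (ann y) = 2 ^ (2 - e)"
  using card_ann_multiple by (auto simp: multiples_iff)

section \<open>Coprime pairs of height 0 and 1\<close>

lemma comaximal_simps [simp]:
  "comaximal 1 p" "comaximal p 1" "comaximal [:0, 1:] [:1, 1:]" "comaximal [:1, 1:] [:0, 1:]"
proof -
  show "comaximal 1 p" for p
    unfolding comaximal_def by (intro exI[of _ 1] exI[of _ 0]) simp
  then show "comaximal p 1" for p by (rule comaximal_commute)
  show "comaximal [:0, 1:] [:1, 1:]"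
    \<comment> \<open>Both Bezout coefficients are 1, since T + (T + 1) = 1 in characteristic
      2.\<close>
    unfolding comaximal_def by (intro exI[of _ 1]) (simp add: pCons_one two_bit_poly_eq_0)
  then show "comaximal [:1, 1:] [:0, 1:]" by (rule comaximal_commute)
qed

lemma comaximal_self: "comaximal p p \<Longrightarrow> p = 1"
  unfolding comaximal_def by (metis bit_poly_mult_eq_1 distrib_right mult.commute)

lemma comaximal_0: "comaximal 0 p \<Longrightarrow> p = 1" "comaximal p 0 \<Longrightarrow> p = 1"
  unfolding comaximal_def using bit_poly_mult_eq_1[of p] by (auto simp: mult.commute)

lemma coprime_pairs_0: "coprime_pairs 0 = {(1, 0), (0, 1), (1, 1)}"
proof -
  have "a \<in> {0, 1} \<and> b \<in> {0, 1}" if "height (a, b) = 0" for a b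
    using that polys_below_Suc_iff[of _ 0]
    by (auto simp: height_def polys_below_Suc polys_below_0 UNIV_bit_eq pCons_one)
  moreover have "\<not> comaximal 0 0" by (auto simp: comaximal_def)
  ultimately show ?thesis
    by (fastforce simp: coprime_pairs_def height_def)
qed

text \<open>A comaximal pair with a zero entry or two equal entries contains only 0 and 1, hence has
  height 0. What remains are the ordered pairs of distinct elements of {1, T, T + 1}.\<close>

lemma coprime_pairs_1:
  "coprime_pairs 1 = {(1, [:0, 1:]), ([:0, 1:], 1), (1, [:1, 1:]), ([:1, 1:], 1),
     ([:0, 1:], [:1, 1:]), ([:1, 1:], [:0, 1:])}" (is "_ = ?S")
proof (intro equalityI subsetI)
  fix z assume "z \<in> coprime_pairs 1"
  then obtain a b where z: "z = (a, b)" and ab: "comaximal a b" "height (a, b) = 1"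
    by (auto simp: coprime_pairs_def)
  then have "a \<in> polys_below 2" "b \<in> polys_below 2"
    by (auto simp: height_def numeral_2_eq_2 polys_below_Suc_iff)
  with ab z show "z \<in> ?S"
    unfolding polys_below_2 by (auto simp: height_def dest: comaximal_self comaximal_0)
qed (auto simp: coprime_pairs_def height_def)

section \<open>Pairs with trivial annihilator\<close>

lemma polys_below_2_pair_cases:
  assumes "u \<in> polys_below 2" "v \<in> polys_below 2" "(u, v) \<noteq> (0, 0)"
  obtains h a b where "h \<noteq> 0" "u = h * b" "v = h * a" "comaximal a b" "height (a, b) \<le> 1"
proof (cases "u = 0 \<or> v = 0 \<or> u = v")
  case True
  then consider "u = 0" | "v = 0" | "u = v" by blast
  then show ?thesis
  proof cases
    case 1
    with assms show ?thesis by (intro that[of v 0 1]) (auto simp: height_def)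
  next
    case 2
    with assms show ?thesis by (intro that[of u 1 0]) (auto simp: height_def)
  next
    case 3
    with assms show ?thesis by (intro that[of u 1 1]) (auto simp: height_def)
  qed
next
  \<comment> \<open>Distinct nonzero polynomials of degree at most 1 are already comaximal, so
    \<open>h = 1\<close> works.\<close>
  case False
  with assms have "comaximal v u" "height (v, u) \<le> 1"
    unfolding polys_below_2 by (auto simp: height_def)
  then show ?thesis by (intro that[of 1 u v]) auto
qed

text \<open>A nonzero annihilating pair is \<open>h\<close> times some \<open>(b, a)\<close> of
  height at most 1. Cancelling \<open>h\<close> makes \<open>y\<close> proportional to
  \<open>(a, b)\<close>, which puts \<open>y\<close> into one of the two excluded classes.\<close>

lemma ann_trivial:
  assumes y: "y \<in> polys_below k \<times> polys_below k" "y \<noteq> (0, 0)"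
    and "y \<notin> multiples k 0" "y \<notin> multiples k 1"
  shows "ann y = {(0, 0)}"
proof (rule ccontr)
  assume ne: "ann y \<noteq> {(0, 0)}"
  have "(0, 0) \<in> ann y" by (auto simp: ann_def split: prod.splits)
  with ne obtain u v where uv: "(u, v) \<in> ann y" "(u, v) \<noteq> (0, 0)" by auto
  obtain y1 y2 where y12: "y = (y1, y2)" by (cases y)
  from uv have "u \<in> polys_below 2" "v \<in> polys_below 2" and eq: "y1 * u = y2 * v"
    by (auto simp: ann_def y12 add_bit_poly_eq_0_iff)
  then obtain h a b where h: "h \<noteq> 0" "u = h * b" "v = h * a"
    and ab: "comaximal a b" "height (a, b) \<le> 1"
    using polys_below_2_pair_cases uv(2) by metis
  from eq h have "y1 * b = y2 * a" by (simp add: mult.left_commute)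
  then obtain g where g: "y1 = g * a" "y2 = g * b"
    using comaximal_proportional ab(1) by blast
  have "g \<in> polys_below (k - height (a, b))"
    using y(1) multiple_in_polys_below_iff[OF ab(1), of g k] by (simp add: y12 g)
  moreover have "g \<noteq> 0" using y(2) by (auto simp: y12 g)
  ultimately have "y \<in> multiples k (height (a, b))"
    unfolding multiples_iff y12 g using ab(1) by blast
  with assms(3,4) ab(2) show False by (auto simp: le_Suc_eq)
qed

section \<open>Evaluating the number of solutions\<close>

lemma R2_eq_sum:
  assumes "k \<ge> 1"
  shows "R2 n k = (\<Sum>y \<in> polys_below k \<times> polys_below k. card (ann y) ^ n)"
proof -
  have "{p. degree p \<le> k - 1} = polys_below k" "{p. degree p \<le> 1} = polys_below 2"
    using assms polys_below_Suc_iff[of _ "k - 1"] polys_below_Suc_iff[of _ 1]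
    by (auto simp: numeral_2_eq_2)
  then have sol: "solutions n k = {(Y1, Y2, U1, U2). Y1 \<in> polys_below k \<and> Y2 \<in> polys_below k \<and>
     U1 \<in> {1..n} \<rightarrow>\<^sub>E polys_below 2 \<and> U2 \<in> {1..n} \<rightarrow>\<^sub>E polys_below 2 \<and>
     (\<forall>j\<in>{1..n}. Y1 * U1 j + Y2 * U2 j = 0)}"
    unfolding solutions_def by blast
  \<comment> \<open>The two families \<open>U1\<close>, \<open>U2\<close> are zipped into one family
    of pairs, so that the equations become membership in \<open>ann y\<close> index by index.
    Restriction to \<open>{1..n}\<close> restores the undefined values outside.\<close>
  let ?A = "SIGMA y : polys_below k \<times> polys_below k. {1..n} \<rightarrow>\<^sub>E ann y"
  let ?f = "\<lambda>((y1, y2), W). (y1, y2, restrict (fst \<circ> W) {1..n}, restrict (snd \<circ> W) {1..n})"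
  let ?g = "\<lambda>(y1, y2, U1, U2). ((y1, y2), \<lambda>j\<in>{1..n}. (U1 j, U2 j))"
  have "bij_betw ?f ?A (solutions n k)"
  proof (rule bij_betw_byWitness[where f' = ?g])
    show "\<forall>x\<in>?A. ?g (?f x) = x"
      by (auto simp: fun_eq_iff PiE_def extensional_def)
    show "\<forall>x\<in>solutions n k. ?f (?g x) = x"
      by (auto simp: sol fun_eq_iff PiE_def extensional_def)
    show "?f ` ?A \<subseteq> solutions n k"
      by (auto simp: sol ann_iff PiE_iff)
    show "?g ` solutions n k \<subseteq> ?A"
      by (auto simp: sol ann_iff PiE_iff)
  qed
  then have "R2 n k = card ?A"
    by (simp add: R2_def bij_betw_same_card)
  also have "\<dots> = (\<Sum>y \<in> polys_below k \<times> polys_below k. card ({1..n} \<rightarrow>\<^sub>E ann y))"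
    using finite_subset[OF ann_subset] by (intro card_SigmaI) (auto intro: finite_PiE)
  also have "\<dots> = (\<Sum>y \<in> polys_below k \<times> polys_below k. card (ann y) ^ n)"
    by (simp add: card_PiE)
  finally show ?thesis .
qed

theorem theorem4p1:
  fixes n k :: nat
  assumes "n \<ge> 1" and "k \<ge> 1"
  shows "int (R2 n k) =
    2 ^ (2 * k) + 3 * (2 ^ (2 * n) - 1) * 2 ^ k + 6 * (2 ^ n - 1) * 2 ^ (k - 1)
      + 2 ^ (4 * n) - 3 * 2 ^ (2 * n) - 6 * 2 ^ n + 8"
proof -
  let ?P = "polys_below k \<times> polys_below k"
  let ?Z = "{(0, 0)} :: (bit poly \<times> bit poly) set"
  let ?M0 = "multiples k 0" and ?M1 = "multiples k 1"
  \<comment> \<open>Where \<open>ann y\<close> is trivial the summand is \<open>1 ^ n = 1\<close>.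
    Subtracting 1 everywhere splits off the term \<open>2 ^ (2 * k)\<close> and leaves a sum
    supported on \<open>?Z\<close>, \<open>?M0\<close> and \<open>?M1\<close>.\<close>
  let ?F = "\<lambda>y. int (card (ann y) ^ n) - 1"
  have fin: "finite ?M0" "finite ?M1"
    using finite_subset[OF multiples_subset] by auto
  have sub: "?Z \<union> ?M0 \<union> ?M1 \<subseteq> ?P"
    using multiples_subset[of k 0] multiples_subset[of k 1] by auto
  have Z: "card (ann (0, 0)) = 16"
  proof -
    have "ann (0, 0) = polys_below 2 \<times> polys_below 2" by (auto simp: ann_def)
    then show ?thesis by (simp add: card_cartesian_product card_polys_below)
  qed
  have c0: "int (card ?M0) = 3 * (2 ^ k - 1)"
    unfolding card_multiples coprime_pairs_0 of_nat_mult by (simp add: of_nat_diff)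
  have c1: "int (card ?M1) = 6 * (2 ^ (k - 1) - 1)"
    unfolding card_multiples coprime_pairs_1 of_nat_mult by (simp add: of_nat_diff)
  have "int (R2 n k) - 2 ^ (2 * k) = sum ?F ?P"
    using \<open>k \<ge> 1\<close>
    by (simp add: R2_eq_sum sum_subtractf card_cartesian_product card_polys_below
        mult_2 power_add)
  also have "\<dots> = sum ?F (?Z \<union> ?M0 \<union> ?M1)"
    using sub ann_trivial[of _ k] by (intro sum.mono_neutral_right) auto
  also have "\<dots> = sum ?F ?Z + sum ?F ?M0 + sum ?F ?M1"
    using fin multiples_disjoint[of 0 1 k] zero_notin_multiples[of k]
    by (subst sum.union_disjoint, auto)+
  also have "sum ?F ?Z = 16 ^ n - 1" by (simp add: Z)
  also have "sum ?F ?M0 = 3 * (2 ^ k - 1) * (4 ^ n - 1)"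
    by (simp add: card_ann_multiples c0)
  also have "sum ?F ?M1 = 6 * (2 ^ (k - 1) - 1) * (2 ^ n - 1)"
    using c1 by (simp add: card_ann_multiples)
  finally have "int (R2 n k) = 2 ^ (2 * k) + (16 ^ n - 1) + 3 * (2 ^ k - 1) * (4 ^ n - 1)
      + 6 * (2 ^ (k - 1) - 1) * (2 ^ n - 1)" by simp
  moreover have "(16 :: int) ^ n = 2 ^ (4 * n)" "(4 :: int) ^ n = 2 ^ (2 * n)"
    by (simp_all add: power_mult)
  ultimately show ?thesis by (simp add: algebra_simps)
qed

end
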